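(* Let $k\geq2$, let $X$ be a countably based $T_0$-space, let $\delta:D\to X$ ($D\subseteq\mathcal{N}$) be an admissible representation of $X$, let $A:X\to k$ be a $k$-partition of $X$, let $\theta\geq1$ be a countable ordinal and let $F$ be a countable $k$-forest. Then $A\in\mathbf{\Sigma}^0_\theta(X,F)$ if and only if $A\circ\delta\in\mathbf{\Sigma}^0_\theta(D,F)$, where $D$ carries the subspace topology of $\mathcal{N}$.
   Context: $\mathcal{N}=\omega^\omega$ is the Baire space. An admissible representation of $X$ is a continuous surjection $\delta:D\to X$ with $D\subseteq\mathcal{N}$ such that for every $Z\subseteq\mathcal{N}$ and every continuous $\nu:Z\to X$ there is a continuous $g:Z\to\mathcal{N}$ with $\nu=\delta\circ g$. For a space $Y$: $\mathbf{\Sigma}^0_1(Y)$ the open sets; $\mathbf{\Sigma}^0_2(Y)$ the countable unions of sets $U\setminus V$ with $U,V$ open; for $2<\alpha<\omega_1$, $\mathbf{\Sigma}^0_\alpha(Y)$ the countable unions of complements of sets in $\bigcup_{\beta<\alpha}\mathbf{\Sigma}^0_\beta(Y)$ (with $\mathbf{\Sigma}^0_0(Y)=\{\emptyset\}$). A countable $k$-forest is a countable poset $(P;\leq)$ without infinite chains in which every upper cone $\{y\mid x\leq y\}$ is a chain, with a labeling $c:P\to k=\{0,\dots,k-1\}$. $\mathbf{\Sigma}^0_\theta(Y,F)$ is the set of $k$-partitions $A:Y\to k$ for which there exist $B_p\in\mathbf{\Sigma}^0_\theta(Y)$ ($p\in F$) with $\bigcup_pB_p=Y$ and $A^{-1}(i)=\bigcup\{B_p\setminus\bigcup_{q<p}B_q\mid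 c(p)=i\}$ for each $i<k$. *)

theory Defs
  imports "HOL-Analysis.Analysis"
begin

definition baire :: "(nat \<Rightarrow> nat) topology" where
  "baire = product_topology (\<lambda>_. discrete_topology (UNIV :: nat set)) UNIV"

definition admissible_rep :: "'a topology \<Rightarrow> (nat \<Rightarrow> nat) set \<Rightarrow> ((nat \<Rightarrow> nat) \<Rightarrow> 'a) \<Rightarrow> bool" where
  "admissible_rep X D \<delta> \<longleftrightarrow>
     continuous_map (subtopology baire D) X \<delta> \<and> \<delta> ` D = topspace X \<and>
     (\<forall>Z \<nu>. continuous_map (subtopology baire Z) X \<nu> \<longrightarrow>
        (\<exists>g. continuous_map (subtopology baire Z) (subtopology baire D) g \<and>
             (\<forall>z\<in>Z. \<nu> z = \<delta> (g z))))"

definition cunions :: "'a set set \<Rightarrow> 'a set set" where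
  "cunions C = {\<Union>\<U> | \<U>. countable \<U> \<and> \<U> \<subseteq> C}"

text \<open>Borel classes. Ordinals are represented by elements of a well-order r:
  the element t stands for the order type of its strict initial segment underS r t.
  Thus t has level 0, 1, 2 iff underS r t has 0, 1, 2 elements.\<close>
definition borel_sigma :: "'a topology \<Rightarrow> 'i rel \<Rightarrow> 'i \<Rightarrow> 'a set set" where
  "borel_sigma Y r = wfrec (r - Id) (\<lambda>S t.
     if underS r t = {} then {{}}
     else if finite (underS r t) \<and> card (underS r t) = 1 then {U. openin Y U}
     else if finite (underS r t) \<and> card (underS r t) = 2 then
       cunions {U - V | U V. openin Y U \<and> openin Y V}
     else cunions {topspace Y - B | B. B \<in> (\<Union>s\<in>underS r t. S s)})"

definition k_forest :: "nat \<Rightarrow> 'p set \<Rightarrow> ('p \<Rightarrow> 'p \<Rightarrow> bool) \<Rightarrow> ('p \<Rightarrow> nat) \<Rightarrow> bool" where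
  "k_forest k P le c \<longleftrightarrow>
     countable P \<and>
     (\<forall>x\<in>P. le x x) \<and>
     (\<forall>x\<in>P. \<forall>y\<in>P. le x y \<and> le y x \<longrightarrow> x = y) \<and>
     (\<forall>x\<in>P. \<forall>y\<in>P. \<forall>z\<in>P. le x y \<and> le y z \<longrightarrow> le x z) \<and>
     (\<forall>C. C \<subseteq> P \<and> (\<forall>x\<in>C. \<forall>y\<in>C. le x y \<or> le y x) \<longrightarrow> finite C) \<and>
     (\<forall>x\<in>P. \<forall>y\<in>P. \<forall>z\<in>P. le x y \<and> le x z \<longrightarrow> le y z \<or> le z y) \<and>
     (\<forall>x\<in>P. c x < k)"

definition sigma_forest ::
  "'a topology \<Rightarrow> 'i rel \<Rightarrow> 'i \<Rightarrow> nat \<Rightarrow> 'p set \<Rightarrow> ('p \<Rightarrow> 'p \<Rightarrow> bool) \<Rightarrow> ('p \<Rightarrow> nat)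
     \<Rightarrow> ('a \<Rightarrow> nat) \<Rightarrow> bool" where
  "sigma_forest Y r t k P le c A \<longleftrightarrow>
     (\<exists>B :: 'p \<Rightarrow> 'a set.
        (\<forall>p\<in>P. B p \<in> borel_sigma Y r t) \<and>
        (\<Union>p\<in>P. B p) = topspace Y \<and>
        (\<forall>i<k. {y \<in> topspace Y. A y = i} =
           (\<Union>p\<in>{p\<in>P. c p = i}. B p - (\<Union>q\<in>{q\<in>P. le q p \<and> q \<noteq> p}. B q))))"

end

theory Submission
  imports Defs
begin

text \<open>For the nontrivial direction, represent \<open>X\<close> by a continuous open surjection \<open>\<rho>\<close> from a
  subspace \<open>E\<close> of the Baire space all of whose fibers are Polish. By admissibility \<open>\<rho>\<close> factors
  continuously through \<open>\<delta>\<close>, so \<open>A \<circ> \<rho>\<close> is defined by a family \<open>B p\<close> on \<open>E\<close>. The category quantifier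
  \<open>C p = {x. B p is nonmeager in the fiber over x}\<close> preserves the Borel level, because \<open>\<rho>\<close> is open and
  Borel sets have the Baire property. The fibers being Baire spaces, the \<open>C p\<close> cover \<open>X\<close>; and if
  \<open>x\<close> is in \<open>C p\<close> but in no \<open>C q\<close> with \<open>q < p\<close>, then the fiber over \<open>x\<close> meets \<open>B p\<close> minus the union
  of those \<open>B q\<close>, so \<open>A x = c p\<close>. Since descending chains in \<open>P\<close> are finite, each \<open>x\<close> is in a minimal
  \<open>C p\<close>, so the family \<open>C p\<close> defines \<open>A\<close>.\<close>

section \<open>Meager sets and the Baire property\<close>

text \<open>Covering by closed sets with empty interior makes the passage to subsets immediate and
  is the form to which \<open>Baire_category_alt\<close> applies.\<close>

definition meager_in :: "'a topology \<Rightarrow> 'a set \<Rightarrow> bool" where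
  "meager_in T S \<longleftrightarrow>
     (\<exists>\<N>. countable \<N> \<and> (\<forall>N\<in>\<N>. closedin T N \<and> T interior_of N = {}) \<and> S \<subseteq> \<Union>\<N>)"

lemma meager_in_empty [simp]: "meager_in T {}"
  unfolding meager_in_def by (intro exI [of _ "{}"]) auto

lemma meager_in_mono: "meager_in T S \<Longrightarrow> R \<subseteq> S \<Longrightarrow> meager_in T R"
  unfolding meager_in_def by (meson subset_trans)

lemma meager_in_UN:
  assumes "countable I" and "\<And>i. i \<in> I \<Longrightarrow> meager_in T (S i)"
  shows "meager_in T (\<Union>i\<in>I. S i)"
proof -
  obtain \<N> where N: "\<And>i. i \<in> I \<Longrightarrow> countable (\<N> i) \<and>
      (\<forall>N\<in>\<N> i. closedin T N \<and> T interior_of N = {}) \<and> S i \<subseteq> \<Union>(\<N> i)"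
    using assms(2) unfolding meager_in_def by metis
  show ?thesis
    unfolding meager_in_def
  proof (intro exI conjI)
    show "countable (\<Union>i\<in>I. \<N> i)"
      using assms(1) N by blast
    show "\<forall>N\<in>(\<Union>i\<in>I. \<N> i). closedin T N \<and> T interior_of N = {}"
      using N by blast
    show "(\<Union>i\<in>I. S i) \<subseteq> \<Union>(\<Union>i\<in>I. \<N> i)"
      using N by fastforce
  qed
qed

lemma meager_in_Un:
  assumes "meager_in T R" "meager_in T S"
  shows "meager_in T (R \<union> S)"
proof -
  have "meager_in T (\<Union>X\<in>{R, S}. X)"
    using assms by (intro meager_in_UN) auto
  then show ?thesis by simp
qed

text \<open>\<open>U - G\<close> need not be closed, so it is enlarged to the closure of
  \<open>U\<close> minus \<open>G\<close>. A nonempty open set inside that would meet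
  \<open>U\<close>, giving a nonempty open part of \<open>U\<close> that avoids
  \<open>G\<close>.\<close>

lemma meager_in_open_diff_dense:
  assumes U: "openin T U" and G: "openin T G"
    and dense: "\<And>V. openin T V \<Longrightarrow> V \<noteq> {} \<Longrightarrow> V \<subseteq> U \<Longrightarrow> V \<inter> G \<noteq> {}"
  shows "meager_in T (U - G)"
proof -
  let ?N = "T closure_of U - G"
  have "T interior_of ?N = {}"
  proof (rule ccontr)
    assume "T interior_of ?N \<noteq> {}"
    then obtain x V where V: "openin T V" "x \<in> V" "V \<subseteq> ?N"
      unfolding interior_of_def by blast
    then have "x \<in> T closure_of U"
      by blast
    then have "V \<inter> U \<noteq> {}"
      using V unfolding in_closure_of by blast
    moreover have "openin T (V \<inter> U)"
      using V U by blast
    ultimately show False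
      using dense [of "V \<inter> U"] V by blast
  qed
  moreover have "closedin T ?N"
    using G by (simp add: closedin_diff)
  moreover have "U - G \<subseteq> ?N"
    using closure_of_subset [OF openin_subset [OF U]] by blast
  ultimately show ?thesis
    unfolding meager_in_def by (intro exI [of _ "{?N}"]) auto
qed

text \<open>A localization principle: only countably many basic open sets have a meager intersection
  with \<open>S\<close>, and by \<open>loc\<close> their union is dense in \<open>U\<close>, so what
  they leave of \<open>U\<close> is meager as well.\<close>

lemma meager_in_local:
  assumes T: "second_countable T" and U: "openin T U"
    and loc: "\<And>V. openin T V \<Longrightarrow> V \<noteq> {} \<Longrightarrow> V \<subseteq> U \<Longrightarrow>
      \<exists>W. openin T W \<and> W \<noteq> {} \<and> W \<subseteq> V \<and> meager_in T (W \<inter> S)"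
  shows "meager_in T (U \<inter> S)"
proof -
  obtain \<B> where B: "countable \<B>" "\<And>V. V \<in> \<B> \<Longrightarrow> openin T V"
    "\<And>V x. openin T V \<Longrightarrow> x \<in> V \<Longrightarrow> \<exists>b\<in>\<B>. x \<in> b \<and> b \<subseteq> V"
    using T unfolding second_countable_def by metis
  define \<C> where "\<C> = {b \<in> \<B>. meager_in T (b \<inter> S)}"
  have "meager_in T (U - \<Union>\<C>)"
  proof (rule meager_in_open_diff_dense [OF U])
    show "openin T (\<Union>\<C>)"
      using B(2) unfolding \<C>_def by blast
    fix V assume "openin T V" "V \<noteq> {}" "V \<subseteq> U"
    from loc [OF this] obtain W where W: "openin T W" "W \<noteq> {}" "W \<subseteq> V" "meager_in T (W \<inter> S)"
      by blast
    then obtain x b where b: "b \<in> \<B>" "x \<in> b" "b \<subseteq> W"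
      using B(3) [OF W(1)] by blast
    have "meager_in T (b \<inter> S)"
      using b(3) by (intro meager_in_mono [OF W(4)]) blast
    then have "b \<in> \<C>"
      using b(1) unfolding \<C>_def by blast
    then show "V \<inter> \<Union>\<C> \<noteq> {}"
      using b W by blast
  qed
  moreover have "meager_in T (\<Union>b\<in>\<C>. b \<inter> S)"
    using B(1) unfolding \<C>_def by (intro meager_in_UN) simp_all
  ultimately show ?thesis
    by (rule meager_in_mono [OF meager_in_Un]) blast
qed

text \<open>This is equivalent to the Baire property; the closure of the Borel sets under complements
  is immediate for it.\<close>
definition decided_in :: "'a topology \<Rightarrow> 'a set \<Rightarrow> bool" where
  "decided_in T S \<longleftrightarrow>
     (\<forall>V. openin T V \<and> V \<noteq> {} \<longrightarrow>
        (\<exists>W. openin T W \<and> W \<noteq> {} \<and> W \<subseteq> V \<and> (meager_in T (W \<inter> S) \<or> meager_in T (W - S))))"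

lemma decided_in_openin:
  assumes "openin T U"
  shows "decided_in T U"
  unfolding decided_in_def
proof (intro allI impI)
  fix V assume V: "openin T V \<and> V \<noteq> {}"
  show "\<exists>W. openin T W \<and> W \<noteq> {} \<and> W \<subseteq> V \<and> (meager_in T (W \<inter> U) \<or> meager_in T (W - U))"
  proof (cases "V \<inter> U = {}")
    case True
    then show ?thesis using V by (intro exI [of _ V]) auto
  next
    case False
    then show ?thesis using V assms
      by (intro exI [of _ "V \<inter> U"]) (auto simp: Diff_eq)
  qed
qed

lemma decided_in_Diff_topspace:
  assumes "decided_in T S"
  shows "decided_in T (topspace T - S)"
  unfolding decided_in_def
proof (intro allI impI)
  fix V assume "openin T V \<and> V \<noteq> {}"
  then obtain W where W: "openin T W" "W \<noteq> {}" "W \<subseteq> V" "meager_in T (W \<inter> S) \<or> meager_in T (W - S)"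
    using assms unfolding decided_in_def by blast
  have "W \<inter> (topspace T - S) = W - S" "W - (topspace T - S) = W \<inter> S"
    using openin_subset [OF W(1)] by auto
  then show "\<exists>W. openin T W \<and> W \<noteq> {} \<and> W \<subseteq> V \<and>
      (meager_in T (W \<inter> (topspace T - S)) \<or> meager_in T (W - (topspace T - S)))"
    using W by (intro exI [of _ W]) auto
qed

text \<open>Either some member of the family is comeager in some nonempty open piece of
  \<open>V\<close>, and then so is the union; or every member is meager on densely many pieces,
  hence on \<open>V\<close> by \<open>meager_in_local\<close>, and then so is the countable
  union.\<close>

lemma decided_in_Union:
  assumes T: "second_countable T" and "countable \<S>" and dec: "\<And>S. S \<in> \<S> \<Longrightarrow> decided_in T S"
  shows "decided_in T (\<Union>\<S>)"
  unfolding decided_in_def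
proof (intro allI impI)
  fix V assume V: "openin T V \<and> V \<noteq> {}"
  show "\<exists>W. openin T W \<and> W \<noteq> {} \<and> W \<subseteq> V \<and> (meager_in T (W \<inter> \<Union>\<S>) \<or> meager_in T (W - \<Union>\<S>))"
  proof (cases "\<exists>S\<in>\<S>. \<exists>W. openin T W \<and> W \<noteq> {} \<and> W \<subseteq> V \<and> meager_in T (W - S)")
    case True
    then obtain S W where W: "S \<in> \<S>" "openin T W" "W \<noteq> {}" "W \<subseteq> V" "meager_in T (W - S)"
      by blast
    then have "meager_in T (W - \<Union>\<S>)"
      by (intro meager_in_mono [OF W(5)]) auto
    then show ?thesis using W by blast
  next
    case False
    have "meager_in T (V \<inter> S)" if S: "S \<in> \<S>" for S
    proof (rule meager_in_local [OF T])
      fix U assume "openin T U" "U \<noteq> {}" "U \<subseteq> V"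
      then show "\<exists>W. openin T W \<and> W \<noteq> {} \<and> W \<subseteq> U \<and> meager_in T (W \<inter> S)"
        using dec [OF S] False S unfolding decided_in_def by (meson subset_trans)
    qed (use V in blast)
    then have "meager_in T (\<Union>S\<in>\<S>. V \<inter> S)"
      using assms(2) by (intro meager_in_UN) auto
    then have "meager_in T (V \<inter> \<Union>\<S>)"
      by (rule meager_in_mono) blast
    then show ?thesis using V by blast
  qed
qed

text \<open>Otherwise every nonempty open part of \<open>U\<close> would contain a piece on which
  the complement of \<open>S\<close> is meager, and localization would make \<open>U - S\<close>
  meager.\<close>

lemma decided_in_diff_not_meager:
  assumes T: "second_countable T" and S: "decided_in T S" and U: "openin T U"
    and nonm: "\<not> meager_in T (U - S)"
  obtains W where "openin T W" "W \<noteq> {}" "W \<subseteq> U" "meager_in T (W \<inter> S)"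
proof (rule ccontr)
  assume "\<not> thesis"
  with that have no: "\<not> meager_in T (W \<inter> S)" if "openin T W" "W \<noteq> {}" "W \<subseteq> U" for W
    using \<open>openin T W\<close> \<open>W \<noteq> {}\<close> \<open>W \<subseteq> U\<close> by metis
  have "meager_in T (U \<inter> - S)"
  proof (rule meager_in_local [OF T U])
    fix V assume V: "openin T V" "V \<noteq> {}" "V \<subseteq> U"
    then obtain W where W: "openin T W" "W \<noteq> {}" "W \<subseteq> V"
      "meager_in T (W \<inter> S) \<or> meager_in T (W - S)"
      using S unfolding decided_in_def by blast
    then have "meager_in T (W \<inter> - S)"
      using no [of W] V(3) by (auto simp: Diff_eq)
    then show "\<exists>W. openin T W \<and> W \<noteq> {} \<and> W \<subseteq> V \<and> meager_in T (W \<inter> - S)"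
      using W by blast
  qed
  then show False
    using nonm by (simp add: Diff_eq)
qed

lemma openin_not_meager:
  assumes "completely_metrizable_space T" "openin T U" "U \<noteq> {}"
  shows "\<not> meager_in T U"
proof
  assume "meager_in T U"
  then obtain \<N> where N: "countable \<N>" "\<And>N. N \<in> \<N> \<Longrightarrow> closedin T N \<and> T interior_of N = {}" "U \<subseteq> \<Union>\<N>"
    unfolding meager_in_def by blast
  have "T interior_of \<Union>\<N> = {}"
    by (rule Baire_category_alt [OF disjI1 [OF assms(1)] N(1,2)])
  then show False
    using assms(2,3) interior_of_maximal [OF N(3) assms(2)] by simp
qed

section \<open>Borel classes\<close>

lemma wf_strict_Well_order: "Well_order r \<Longrightarrow> wf (r - Id)"
  by (simp add: well_order_on_def)

lemma borel_sigma_unfold: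
  assumes "Well_order r"
  shows "borel_sigma Y r t =
    (if underS r t = {} then {{}}
     else if finite (underS r t) \<and> card (underS r t) = 1 then {U. openin Y U}
     else if finite (underS r t) \<and> card (underS r t) = 2 then
       cunions {U - V | U V. openin Y U \<and> openin Y V}
     else cunions {topspace Y - B | B. B \<in> (\<Union>s\<in>underS r t. borel_sigma Y r s)})"
proof -
  \<comment> \<open>The recursion consults only strictly smaller elements, so \<open>cut\<close>
    changes no value that is used.\<close>
  have "(s, t) \<in> r - Id" if "s \<in> underS r t" for s
    using that unfolding underS_def by auto
  then have "(\<Union>s\<in>underS r t. cut (borel_sigma Y r) (r - Id) t s) = (\<Union>s\<in>underS r t. borel_sigma Y r s)"
    by (auto simp: cut_apply)
  then show ?thesis
    by (subst def_wfrec [OF borel_sigma_def [THEN eq_reflection] wf_strict_Well_order [OF assms]])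
       (simp only:)
qed

text \<open>The levels from 3 on, where \<open>borel_sigma\<close> takes complements from all lower
  levels.\<close>

definition high_level :: "'i rel \<Rightarrow> 'i \<Rightarrow> bool" where
  "high_level r t \<longleftrightarrow> infinite (underS r t) \<or> card (underS r t) > 2"

lemma level_cases:
  obtains "underS r t = {}"
  | "finite (underS r t)" "card (underS r t) = 1"
  | "finite (underS r t)" "card (underS r t) = 2"
  | "high_level r t"
  unfolding high_level_def by (metis card_0_eq less_2_cases nat_neq_iff One_nat_def)

lemma borel_sigma_0:
  "Well_order r \<Longrightarrow> underS r t = {} \<Longrightarrow> borel_sigma Y r t = {{}}"
  by (simp add: borel_sigma_unfold)

lemma borel_sigma_1:
  "Well_order r \<Longrightarrow> finite (underS r t) \<Longrightarrow> card (underS r t) = 1 \<Longrightarrow>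
    borel_sigma Y r t = {U. openin Y U}"
  by (subst borel_sigma_unfold) auto

lemma borel_sigma_2:
  "Well_order r \<Longrightarrow> finite (underS r t) \<Longrightarrow> card (underS r t) = 2 \<Longrightarrow>
    borel_sigma Y r t = cunions {U - V | U V. openin Y U \<and> openin Y V}"
  by (subst borel_sigma_unfold) auto

lemma borel_sigma_high:
  "Well_order r \<Longrightarrow> high_level r t \<Longrightarrow>
    borel_sigma Y r t = cunions {topspace Y - B | B. B \<in> (\<Union>s\<in>underS r t. borel_sigma Y r s)}"
  by (subst borel_sigma_unfold) (auto simp: high_level_def)

text \<open>\<open>Q\<close> takes the level as an argument so that preservation of the level can be
  proved. Levels 1 and 2 are base cases, being defined from open sets directly. The last case keeps
  membership in the lower class beside \<open>Q s B\<close>, so that facts about Borel sets apply to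
  \<open>B\<close>.\<close>

lemma borel_sigma_induct [consumes 3, case_names zero one two high]:
  assumes r: "Well_order r" and "t \<in> Field r" and B: "B \<in> borel_sigma Y r t"
    and zero: "\<And>t. t \<in> Field r \<Longrightarrow> underS r t = {} \<Longrightarrow> Q t {}"
    and one: "\<And>t U. t \<in> Field r \<Longrightarrow> finite (underS r t) \<Longrightarrow> card (underS r t) = 1 \<Longrightarrow>
      openin Y U \<Longrightarrow> Q t U"
    and two: "\<And>t \<U>. t \<in> Field r \<Longrightarrow> finite (underS r t) \<Longrightarrow> card (underS r t) = 2 \<Longrightarrow> countable \<U> \<Longrightarrow>
      (\<And>C. C \<in> \<U> \<Longrightarrow> \<exists>U V. C = U - V \<and> openin Y U \<and> openin Y V) \<Longrightarrow> Q t (\<Union>\<U>)"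
    and high: "\<And>t \<U>. t \<in> Field r \<Longrightarrow> high_level r t \<Longrightarrow> countable \<U> \<Longrightarrow>
      (\<And>C. C \<in> \<U> \<Longrightarrow> \<exists>s B. C = topspace Y - B \<and> s \<in> underS r t \<and> B \<in> borel_sigma Y r s \<and> Q s B) \<Longrightarrow>
      Q t (\<Union>\<U>)"
  shows "Q t B"
  using assms(2) B
proof (induction t arbitrary: B rule: wf_induct_rule [OF wf_strict_Well_order [OF r]])
  case (1 t)
  show ?case
  proof (cases rule: level_cases [of r t])
    case 1
    then show ?thesis using "1.prems" r zero by (auto simp: borel_sigma_0)
  next
    case 2
    then show ?thesis using "1.prems" r one by (auto simp: borel_sigma_1)
  next
    case 3
    then obtain \<U> where "countable \<U>" "B = \<Union>\<U>" "\<U> \<subseteq> {U - V | U V. openin Y U \<and> openin Y V}"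
      using "1.prems"(2) by (auto simp: borel_sigma_2 [OF r] cunions_def)
    then show ?thesis using two [OF "1.prems"(1) 3] by blast
  next
    case 4
    then obtain \<U> where U: "countable \<U>" "B = \<Union>\<U>"
      "\<U> \<subseteq> {topspace Y - B | B. B \<in> (\<Union>s\<in>underS r t. borel_sigma Y r s)}"
      using "1.prems"(2) by (auto simp: borel_sigma_high [OF r] cunions_def)
    have IH: "Q s C" if "s \<in> underS r t" "C \<in> borel_sigma Y r s" for s C
      using that "1.IH" [of s C] unfolding underS_def by (auto intro: FieldI1)
    show ?thesis
      unfolding U(2)
    proof (rule high [OF "1.prems"(1) 4 U(1)])
      fix C assume "C \<in> \<U>"
      then obtain s D where "C = topspace Y - D" "s \<in> underS r t" "D \<in> borel_sigma Y r s"
        using U(3) by auto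
      then show "\<exists>s B. C = topspace Y - B \<and> s \<in> underS r t \<and> B \<in> borel_sigma Y r s \<and> Q s B"
        using IH by blast
    qed
  qed
qed

section \<open>Countable unions, preimages and the Baire property of Borel sets\<close>

lemma cunions_generator: "C \<in> \<C> \<Longrightarrow> C \<in> cunions \<C>"
  unfolding cunions_def by (auto intro!: exI [of _ "{C}"])

lemma cunions_UN:
  assumes "countable I" and "\<And>i. i \<in> I \<Longrightarrow> S i \<in> cunions \<C>"
  shows "(\<Union>i\<in>I. S i) \<in> cunions \<C>"
proof -
  obtain \<U> where U: "\<And>i. i \<in> I \<Longrightarrow> S i = \<Union>(\<U> i) \<and> countable (\<U> i) \<and> \<U> i \<subseteq> \<C>"
    using assms(2) unfolding cunions_def by simp metis
  have "(\<Union>i\<in>I. S i) = \<Union>(\<Union>i\<in>I. \<U> i)" "countable (\<Union>i\<in>I. \<U> i)" "(\<Union>i\<in>I. \<U> i) \<subseteq> \<C>"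
    using U assms(1) by auto
  then show ?thesis
    unfolding cunions_def by blast
qed

lemma borel_sigma_UN:
  assumes r: "Well_order r" and "countable I" and "\<And>i. i \<in> I \<Longrightarrow> S i \<in> borel_sigma Y r t"
  shows "(\<Union>i\<in>I. S i) \<in> borel_sigma Y r t"
proof (cases rule: level_cases [of r t])
  case 1
  then show ?thesis using assms(3) by (auto simp: borel_sigma_0 [OF r])
next
  case 2
  then show ?thesis using assms(3) by (auto simp: borel_sigma_1 [OF r])
next
  case 3
  then show ?thesis using assms by (simp add: borel_sigma_2 [OF r] cunions_UN)
next
  case 4
  then show ?thesis using assms by (simp only: borel_sigma_high [OF r] cunions_UN)
qed

lemma borel_sigma_Un:
  assumes "Well_order r" "R \<in> borel_sigma Y r t" "S \<in> borel_sigma Y r t"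
  shows "R \<union> S \<in> borel_sigma Y r t"
  using borel_sigma_UN [of r "{R, S}" id Y t] assms by auto

lemma borel_sigma_subset_topspace:
  assumes "Well_order r" "t \<in> Field r" "B \<in> borel_sigma Y r t"
  shows "B \<subseteq> topspace Y"
  using assms
proof (induction rule: borel_sigma_induct)
  case (one t U)
  then show ?case by (rule_tac openin_subset)
next
  case (two t \<U>)
  show ?case
  proof (rule Sup_least)
    fix C assume "C \<in> \<U>"
    then obtain U V where "C = U - V" "openin Y U"
      using two(5) by blast
    then show "C \<subseteq> topspace Y"
      using openin_subset by fastforce
  qed
next
  case (high t \<U>)
  show ?case
  proof (rule Sup_least)
    fix C assume "C \<in> \<U>"
    then show "C \<subseteq> topspace Y"
      using high(4) by blast
  qed
qed simp

lemma borel_sigma_vimage: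
  assumes f: "continuous_map Y Z f" and "Well_order r" "t \<in> Field r" "B \<in> borel_sigma Z r t"
  shows "{y \<in> topspace Y. f y \<in> B} \<in> borel_sigma Y r t"
  using assms(2-4)
proof (induction rule: borel_sigma_induct)
  case (zero t)
  then show ?case by (simp add: borel_sigma_0 [OF assms(2)])
next
  case (one t U)
  then show ?case
    using f by (simp add: borel_sigma_1 [OF assms(2)] openin_continuous_map_preimage)
next
  case (two t \<U>)
  have eq: "{y \<in> topspace Y. f y \<in> \<Union>\<U>} = (\<Union>C\<in>\<U>. {y \<in> topspace Y. f y \<in> C})"
    by auto
  show ?case
    unfolding eq
  proof (rule borel_sigma_UN [OF assms(2) two(4)])
    fix C assume "C \<in> \<U>"
    then obtain U V where "C = U - V" "openin Z U" "openin Z V"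
      using two(5) by blast
    then have "{y \<in> topspace Y. f y \<in> C} = {y \<in> topspace Y. f y \<in> U} - {y \<in> topspace Y. f y \<in> V}"
      "openin Y {y \<in> topspace Y. f y \<in> U}" "openin Y {y \<in> topspace Y. f y \<in> V}"
      using openin_continuous_map_preimage [OF f] by auto
    then show "{y \<in> topspace Y. f y \<in> C} \<in> borel_sigma Y r t"
      unfolding borel_sigma_2 [OF assms(2) two(2,3)] by (intro cunions_generator) blast
  qed
next
  case (high t \<U>)
  have eq: "{y \<in> topspace Y. f y \<in> \<Union>\<U>} = (\<Union>C\<in>\<U>. {y \<in> topspace Y. f y \<in> C})"
    by auto
  show ?case
    unfolding eq
  proof (rule borel_sigma_UN [OF assms(2) high(3)])
    fix C assume "C \<in> \<U>"
    then obtain s B where B: "C = topspace Z - B" "s \<in> underS r t"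
      "{y \<in> topspace Y. f y \<in> B} \<in> borel_sigma Y r s"
      using high(4) by blast
    \<comment> \<open>Since \<open>f\<close> maps into \<open>topspace Z\<close>, preimages commute
      with complements in the whole spaces.\<close>
    moreover have "{y \<in> topspace Y. f y \<in> C} = topspace Y - {y \<in> topspace Y. f y \<in> B}"
      using f B(1) by (auto simp: continuous_map_def)
    ultimately show "{y \<in> topspace Y. f y \<in> C} \<in> borel_sigma Y r t"
      unfolding borel_sigma_high [OF assms(2) high(2)] by (intro cunions_generator) blast
  qed
qed

lemma borel_sigma_decided_in:
  assumes T: "second_countable T" and "Well_order r" "t \<in> Field r" "B \<in> borel_sigma T r t"
  shows "decided_in T B"
  using assms(2-4)
proof (induction rule: borel_sigma_induct)
  case (zero t)
  then show ?case by (simp add: decided_in_openin)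
next
  case (one t U)
  then show ?case by (simp add: decided_in_openin)
next
  case (two t \<U>)
  show ?case
  proof (rule decided_in_Union [OF T two(4)])
    fix C assume "C \<in> \<U>"
    then obtain U V where C: "C = U - V" "openin T U" "openin T V"
      using two(5) by blast
    \<comment> \<open>The difference is the complement of a union, so closure under complements and
      countable unions suffices.\<close>
    then have "decided_in T (topspace T - \<Union>{topspace T - U, V})"
      by (intro decided_in_Diff_topspace decided_in_Union [OF T])
         (auto intro: decided_in_openin decided_in_Diff_topspace)
    moreover have "topspace T - \<Union>{topspace T - U, V} = C"
      using C openin_subset by fastforce
    ultimately show "decided_in T C" by simp
  qed
next
  case (high t \<U>)
  show ?case
    by (rule decided_in_Union [OF T high(3)]) (metis high(4) decided_in_Diff_topspace)
qed

text \<open>If some predecessor itself lies beyond level \<open>n\<close>, induction applies to it.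
  Otherwise, were \<open>n\<close> not attained, counting predecessors would map
  \<open>underS r t\<close> injectively into \<open>{..<n}\<close>, leaving it at most
  \<open>n\<close> elements.\<close>

lemma exists_level:
  assumes r: "Well_order r" and "infinite (underS r t) \<or> n < card (underS r t)"
  shows "\<exists>s\<in>underS r t. finite (underS r s) \<and> card (underS r s) = n"
  using assms(2)
proof (induction t rule: wf_induct_rule [OF wf_strict_Well_order [OF r]])
  case (1 t)
  have tr: "trans r" "antisym r" and tot: "total_on (Field r) r"
    using r by (auto simp: order_on_defs)
  have mono: "underS r s \<subset> underS r u" if "s \<in> underS r u" for s u
    using that tr unfolding underS_def trans_def antisym_def by blast
  show ?case
  proof (cases "\<exists>s\<in>underS r t. infinite (underS r s) \<or> n < card (underS r s)")
    case True
    then obtain s where "s \<in> underS r t" "infinite (underS r s) \<or> n < card (underS r s)"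
      by blast
    moreover from this have "\<exists>u\<in>underS r s. finite (underS r u) \<and> card (underS r u) = n"
      using "1.IH" [of s] unfolding underS_def by auto
    ultimately show ?thesis using mono by blast
  next
    case False
    show ?thesis
    proof (rule ccontr)
      assume "\<not> ?thesis"
      with False have fin: "finite (underS r s)" "card (underS r s) < n" if "s \<in> underS r t" for s
        using that by (force simp: not_less order_le_less)+
      have inj: "inj_on (\<lambda>s. card (underS r s)) (underS r t)"
      proof (rule inj_onI, rule ccontr)
        fix s u assume s: "s \<in> underS r t" "u \<in> underS r t" and eq: "card (underS r s) = card (underS r u)"
          and "s \<noteq> u"
        then have "s \<in> underS r u \<or> u \<in> underS r s"
          using tot unfolding underS_def total_on_def by (blast intro: FieldI1)
        then show False
          using mono fin s eq psubset_card_mono by (metis less_irrefl)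
      qed
      have ran: "(\<lambda>s. card (underS r s)) ` underS r t \<subseteq> {..<n}"
        using fin by auto
      have "finite (underS r t)"
        using inj_on_finite [OF inj ran] by simp
      moreover have "card (underS r t) \<le> n"
        using card_inj_on_le [OF inj ran] by simp
      ultimately show False
        using "1.prems" by simp
    qed
  qed
qed

text \<open>At level 2 a closed set is a difference of open sets; above that it is the complement of
  a set from level 1, which \<open>exists_level\<close> finds below \<open>t\<close>.\<close>

lemma closed_borel_sigma:
  assumes r: "Well_order r" and U: "openin Y U"
    and t: "finite (underS r t) \<and> card (underS r t) = 2 \<or> high_level r t"
  shows "topspace Y - U \<in> borel_sigma Y r t"
  using t
proof
  assume "finite (underS r t) \<and> card (underS r t) = 2"
  then show ?thesis
    using U openin_topspace [of Y] by (auto simp: borel_sigma_2 [OF r] intro!: cunions_generator)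
next
  assume h: "high_level r t"
  then obtain s where "s \<in> underS r t" "finite (underS r s) \<and> card (underS r s) = 1"
    using exists_level [OF r, of t 1] unfolding high_level_def by auto
  moreover from this have "U \<in> borel_sigma Y r s"
    using U by (simp add: borel_sigma_1 [OF r])
  ultimately show ?thesis
    unfolding borel_sigma_high [OF r h] by (intro cunions_generator) blast
qed

text \<open>\<open>U - S\<close> is the complement of \<open>(topspace Y - U) \<union> S\<close>, so
  both parts must be put into one class below \<open>t\<close>. Closed sets are available from level
  2 on; if \<open>S\<close> comes from level 0 or 1, it is open and is moved up to level 2.\<close>

lemma open_diff_borel_sigma:
  assumes r: "Well_order r" and h: "high_level r t" and s: "s \<in> underS r t"
    and S: "S \<in> borel_sigma Y r s" and U: "openin Y U"
  shows "U - S \<in> borel_sigma Y r t"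
proof -
  obtain s2 where s2: "s2 \<in> underS r t" "finite (underS r s2) \<and> card (underS r s2) = 2"
    using exists_level [OF r, of t 2] h unfolding high_level_def by auto
  have "\<exists>u\<in>underS r t. (finite (underS r u) \<and> card (underS r u) = 2 \<or> high_level r u)
      \<and> S \<in> borel_sigma Y r u"
  proof -
    have low: ?thesis if "openin Y S"
    proof (intro bexI [OF _ s2(1)] conjI disjI1)
      show "S \<in> borel_sigma Y r s2"
        unfolding borel_sigma_2 [OF r conjunct1 [OF s2(2)] conjunct2 [OF s2(2)]]
      proof (rule cunions_generator)
        have "S = S - {}" by simp
        then show "S \<in> {U - V | U V. openin Y U \<and> openin Y V}"
          using that openin_empty [of Y] by blast
      qed
    qed (use s2 in auto)
    show ?thesis
    proof (cases rule: level_cases [of r s])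
      case 1
      then show ?thesis using S low by (simp add: borel_sigma_0 [OF r])
    next
      case 2
      then show ?thesis using S low by (simp add: borel_sigma_1 [OF r])
    next
      case 3
      then show ?thesis using S s by blast
    next
      case 4
      then show ?thesis using S s by blast
    qed
  qed
  then obtain u where u: "u \<in> underS r t" "finite (underS r u) \<and> card (underS r u) = 2 \<or> high_level r u"
    "S \<in> borel_sigma Y r u"
    by blast
  have "(topspace Y - U) \<union> S \<in> borel_sigma Y r u"
    using closed_borel_sigma [OF r U u(2)] u(3) by (rule borel_sigma_Un [OF r])
  moreover have "U - S = topspace Y - ((topspace Y - U) \<union> S)"
    using openin_subset [OF U] by auto
  ultimately show ?thesis
    unfolding borel_sigma_high [OF r h] using u(1) by (intro cunions_generator) blast
qed

section \<open>The category quantifier along an open map\<close>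

text \<open>The Vaught transform, that is, the quantifier "for nonmeagerly many points of the
  fiber". The window \<open>W\<close> serves complements: \<open>vaught_diff\<close> trades a
  complement in \<open>W\<close> for transforms in basic windows inside \<open>W\<close>.\<close>

definition vaught :: "'b topology \<Rightarrow> 'a topology \<Rightarrow> ('b \<Rightarrow> 'a) \<Rightarrow> 'b set \<Rightarrow> 'b set \<Rightarrow> 'a set" where
  "vaught Z X f W B = {x \<in> topspace X.
     \<not> meager_in (subtopology Z {z. f z = x}) ({z. f z = x} \<inter> (W \<inter> B))}"

text \<open>These are the ingredients of the transform: open images, a countable base that passes to
  the fibers and yields the Baire property there, and the Baire category theorem in each
  fiber.\<close>

locale polish_fibers =
  fixes Z :: "'b topology" and X :: "'a topology" and f :: "'b \<Rightarrow> 'a"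
  assumes second_countable_Z: "second_countable Z"
    and into: "f ` topspace Z \<subseteq> topspace X"
    and open_map: "open_map Z X f"
    and fiber: "\<And>x. x \<in> topspace X \<Longrightarrow> completely_metrizable_space (subtopology Z {z. f z = x})"
begin

lemma vaught_subset_topspace: "vaught Z X f W B \<subseteq> topspace X"
  unfolding vaught_def by blast

lemma vaught_empty: "vaught Z X f W {} = {}"
  unfolding vaught_def by simp

lemma vaught_Union:
  assumes "countable \<U>"
  shows "vaught Z X f W (\<Union>\<U>) = (\<Union>C\<in>\<U>. vaught Z X f W C)"
proof (intro set_eqI)
  fix x
  let ?T = "subtopology Z {z. f z = x}"
  have eq: "{z. f z = x} \<inter> (W \<inter> \<Union>\<U>) = (\<Union>C\<in>\<U>. {z. f z = x} \<inter> (W \<inter> C))"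
    by blast
  have "meager_in ?T ({z. f z = x} \<inter> (W \<inter> \<Union>\<U>)) \<longleftrightarrow>
      (\<forall>C\<in>\<U>. meager_in ?T ({z. f z = x} \<inter> (W \<inter> C)))"
  proof
    assume "meager_in ?T ({z. f z = x} \<inter> (W \<inter> \<Union>\<U>))"
    then show "\<forall>C\<in>\<U>. meager_in ?T ({z. f z = x} \<inter> (W \<inter> C))"
      by (auto elim!: meager_in_mono)
  next
    assume "\<forall>C\<in>\<U>. meager_in ?T ({z. f z = x} \<inter> (W \<inter> C))"
    then show "meager_in ?T ({z. f z = x} \<inter> (W \<inter> \<Union>\<U>))"
      unfolding eq by (intro meager_in_UN [OF assms]) blast
  qed
  then show "x \<in> vaught Z X f W (\<Union>\<U>) \<longleftrightarrow> x \<in> (\<Union>C\<in>\<U>. vaught Z X f W C)"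
    unfolding vaught_def by auto
qed

text \<open>An open set has an open trace on each fiber, and by the Baire category theorem such a
  trace is nonmeager as soon as it is nonempty.\<close>

lemma vaught_openin:
  assumes W: "openin Z W" and B: "openin Z B"
  shows "vaught Z X f W B = f ` (W \<inter> B)"
proof (intro set_eqI iffI)
  fix x assume "x \<in> vaught Z X f W B"
  then have "{z. f z = x} \<inter> (W \<inter> B) \<noteq> {}"
    unfolding vaught_def by auto
  then show "x \<in> f ` (W \<inter> B)" by blast
next
  fix x assume "x \<in> f ` (W \<inter> B)"
  then obtain z where z: "z \<in> W" "z \<in> B" "f z = x" by blast
  then have x: "x \<in> topspace X"
    using into openin_subset [OF W] by blast
  have "openin (subtopology Z {z. f z = x}) ({z. f z = x} \<inter> (W \<inter> B))"
    using W B by (simp add: openin_subtopology_Int2 openin_Int)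
  then show "x \<in> vaught Z X f W B"
    using openin_not_meager [OF fiber [OF x]] z x unfolding vaught_def by blast
qed

text \<open>The trace is the preimage under the inclusion of the fiber, hence a Borel set of the
  same level in a second countable space.\<close>

lemma borel_sigma_decided_in_fiber:
  assumes "Well_order r" "t \<in> Field r" "B \<in> borel_sigma Z r t"
  shows "decided_in (subtopology Z {z. f z = x}) ({z. f z = x} \<inter> B)"
proof -
  let ?T = "subtopology Z {z. f z = x}"
  have "{y \<in> topspace ?T. y \<in> B} \<in> borel_sigma ?T r t"
    using borel_sigma_vimage [of ?T Z "\<lambda>y. y"] assms
    by (simp add: continuous_map_from_subtopology)
  moreover have "{y \<in> topspace ?T. y \<in> B} = {z. f z = x} \<inter> B"
    using borel_sigma_subset_topspace [OF assms] by auto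
  ultimately show ?thesis
    using borel_sigma_decided_in [OF second_countable_subtopology [OF second_countable_Z] assms(1,2)]
    by simp
qed

text \<open>A set with the Baire property is nonmeager iff it is comeager in some nonempty basic open set.\<close>
lemma vaught_diff:
  assumes base: "\<forall>V\<in>\<B>. openin Z V"
      "\<forall>U z. openin Z U \<and> z \<in> U \<longrightarrow> (\<exists>V\<in>\<B>. z \<in> V \<and> V \<subseteq> U)"
    and W: "openin Z W"
    and dec: "\<And>x. x \<in> topspace X \<Longrightarrow> decided_in (subtopology Z {z. f z = x}) ({z. f z = x} \<inter> B)"
  shows "vaught Z X f W (topspace Z - B) = (\<Union>V\<in>{V\<in>\<B>. V \<subseteq> W}. f ` V - vaught Z X f V B)"
proof (intro set_eqI iffI)
  fix x assume "x \<in> vaught Z X f W (topspace Z - B)"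
  let ?T = "subtopology Z {z. f z = x}"
  let ?F = "{z. f z = x}"
  from \<open>x \<in> vaught Z X f W (topspace Z - B)\<close>
  have x: "x \<in> topspace X" and "\<not> meager_in ?T (?F \<inter> (W \<inter> (topspace Z - B)))"
    unfolding vaught_def by auto
  moreover have "?F \<inter> (W \<inter> (topspace Z - B)) = (?F \<inter> W) - (?F \<inter> B)"
    using openin_subset [OF W] by auto
  ultimately have "\<not> meager_in ?T ((?F \<inter> W) - (?F \<inter> B))"
    by simp
  moreover have "openin ?T (?F \<inter> W)"
    using W by (simp add: openin_subtopology_Int2)
  ultimately obtain U where U: "openin ?T U" "U \<noteq> {}" "U \<subseteq> ?F \<inter> W" "meager_in ?T (U \<inter> (?F \<inter> B))"
    using decided_in_diff_not_meager [OF second_countable_subtopology [OF second_countable_Z] dec [OF x]]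
    by metis
  \<comment> \<open>\<open>U\<close> is the trace of an open set of \<open>Z\<close>. A basic
    \<open>V\<close> around one of its points, chosen inside \<open>W\<close>, meets the fiber while
    \<open>B\<close> is meager in \<open>V\<close> along the fiber.\<close>
  obtain z U' where U': "openin Z U'" "U = U' \<inter> ?F" "z \<in> U"
    using U(1,2) unfolding openin_subtopology by blast
  then obtain V where V: "V \<in> \<B>" "z \<in> V" "V \<subseteq> U' \<inter> W"
    using base(2) [rule_format, of "U' \<inter> W" z] W U(3) by blast
  have "meager_in ?T (?F \<inter> (V \<inter> B))"
    using V(3) U'(2) by (intro meager_in_mono [OF U(4)]) blast
  then have "x \<notin> vaught Z X f V B"
    unfolding vaught_def by blast
  moreover have "x \<in> f ` V"
    using V(2) U'(3) U(3) by blast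
  ultimately show "x \<in> (\<Union>V\<in>{V\<in>\<B>. V \<subseteq> W}. f ` V - vaught Z X f V B)"
    using V by blast
next
  fix x assume "x \<in> (\<Union>V\<in>{V\<in>\<B>. V \<subseteq> W}. f ` V - vaught Z X f V B)"
  then obtain V z where V: "V \<in> \<B>" "V \<subseteq> W" "z \<in> V" "f z = x" "x \<notin> vaught Z X f V B"
    by blast
  let ?T = "subtopology Z {z. f z = x}"
  let ?F = "{z. f z = x}"
  have VZ: "V \<subseteq> topspace Z"
    using base(1) [rule_format, OF V(1)] openin_subset by blast
  then have x: "x \<in> topspace X"
    using into V by blast
  have "\<not> meager_in ?T (?F \<inter> V)"
  proof (rule openin_not_meager [OF fiber [OF x]])
    show "openin ?T (?F \<inter> V)"
      using base(1) [rule_format, OF V(1)] by (simp add: openin_subtopology_Int2)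
  qed (use V in blast)
  \<comment> \<open>The nonmeager trace of \<open>V\<close> splits into a part in \<open>B\<close>,
    which is meager, and a part outside \<open>B\<close>, which must therefore be nonmeager.\<close>
  moreover have "?F \<inter> V \<subseteq> (?F \<inter> (V \<inter> B)) \<union> (?F \<inter> (W \<inter> (topspace Z - B)))"
    using V(2) VZ by blast
  moreover have mVB: "meager_in ?T (?F \<inter> (V \<inter> B))"
    using V(5) x unfolding vaught_def by blast
  ultimately have "\<not> meager_in ?T (?F \<inter> (W \<inter> (topspace Z - B)))"
    using meager_in_mono [OF meager_in_Un [OF mVB]] by blast
  then show "x \<in> vaught Z X f W (topspace Z - B)"
    using x unfolding vaught_def by blast
qed

text \<open>Countable unions pass through the transform, and \<open>vaught_diff\<close> turns a
  complement into a countable union of open images minus transforms. At level 2 these are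
  differences of open sets; at higher levels a set of a lower class is removed from an open set, and
  \<open>open_diff_borel_sigma\<close> applies.\<close>

lemma vaught_borel_sigma:
  assumes r: "Well_order r" and t: "t \<in> Field r" and B: "B \<in> borel_sigma Z r t"
    and "underS r t \<noteq> {}" and "openin Z W"
  shows "vaught Z X f W B \<in> borel_sigma X r t"
proof -
  obtain \<B> where cB: "countable \<B>" and B1: "\<forall>V\<in>\<B>. openin Z V"
    and B2: "\<forall>V x. openin Z V \<and> x \<in> V \<longrightarrow> (\<exists>b\<in>\<B>. x \<in> b \<and> b \<subseteq> V)"
    using second_countable_Z unfolding second_countable_def by blast
  have img: "openin X (f ` V)" if "openin Z V" for V
    using open_map that unfolding open_map_def by blast
  have cB': "countable {V\<in>\<B>. V \<subseteq> W}" for W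
    using cB by simp
  \<comment> \<open>\<open>W\<close> is quantified inside the induction because the complement
    formula uses the transform in every basic subset of \<open>W\<close>.\<close>
  have "\<forall>W. underS r t \<noteq> {} \<and> openin Z W \<longrightarrow> vaught Z X f W B \<in> borel_sigma X r t"
    using r t B
  proof (induction rule: borel_sigma_induct)
    case (zero t)
    then show ?case by simp
  next
    case (one t U)
    then show ?case
      by (simp add: borel_sigma_1 [OF r] vaught_openin img openin_Int)
  next
    case (two t \<U>)
    show ?case
    proof (intro allI impI)
      fix W assume W: "underS r t \<noteq> {} \<and> openin Z W"
      show "vaught Z X f W (\<Union>\<U>) \<in> borel_sigma X r t"
        unfolding vaught_Union [OF two(4)]
      proof (rule borel_sigma_UN [OF r two(4)])
        fix C assume "C \<in> \<U>"
        then obtain U V where C: "C = U - V" "openin Z U" "openin Z V"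
          using two(5) by blast
        \<comment> \<open>Moving \<open>U\<close> into the window leaves the complement of a single
          open set.\<close>
        have "W \<inter> (U - V) = (W \<inter> U) \<inter> (topspace Z - V)"
          using openin_subset [OF C(2)] by blast
        then have "vaught Z X f W C = vaught Z X f (W \<inter> U) (topspace Z - V)"
          unfolding vaught_def C(1) by simp
        also have "\<dots> = (\<Union>G\<in>{G\<in>\<B>. G \<subseteq> W \<inter> U}. f ` G - vaught Z X f G V)"
          using W C by (intro vaught_diff [OF B1 B2] decided_in_openin openin_subtopology_Int2 openin_Int) simp_all
        also have "\<dots> \<in> borel_sigma X r t"
        proof (rule borel_sigma_UN [OF r cB'])
          fix G assume "G \<in> {G\<in>\<B>. G \<subseteq> W \<inter> U}"
          then have "openin Z G" using B1 by blast
          then have "openin X (f ` G)" "openin X (vaught Z X f G V)"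
            using C(3) by (simp_all add: img vaught_openin openin_Int)
          then show "f ` G - vaught Z X f G V \<in> borel_sigma X r t"
            unfolding borel_sigma_2 [OF r two(2,3)] by (intro cunions_generator) blast
        qed
        finally show "vaught Z X f W C \<in> borel_sigma X r t" .
      qed
    qed
  next
    case (high t \<U>)
    show ?case
    proof (intro allI impI)
      fix W assume W: "underS r t \<noteq> {} \<and> openin Z W"
      show "vaught Z X f W (\<Union>\<U>) \<in> borel_sigma X r t"
        unfolding vaught_Union [OF high(3)]
      proof (rule borel_sigma_UN [OF r high(3)])
        fix C assume "C \<in> \<U>"
        then obtain s S where S: "C = topspace Z - S" "s \<in> underS r t" "S \<in> borel_sigma Z r s"
          and IH: "\<forall>W. underS r s \<noteq> {} \<and> openin Z W \<longrightarrow> vaught Z X f W S \<in> borel_sigma X r s"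
          using high(4) by blast
        have s: "s \<in> Field r"
          using S(2) unfolding underS_def by (auto intro: FieldI1)
        have "vaught Z X f W C = (\<Union>G\<in>{G\<in>\<B>. G \<subseteq> W}. f ` G - vaught Z X f G S)"
          unfolding S(1) using W
          by (intro vaught_diff [OF B1 B2] borel_sigma_decided_in_fiber [OF r s S(3)]) simp
        also have "\<dots> \<in> borel_sigma X r t"
        proof (rule borel_sigma_UN [OF r cB'])
          fix G assume "G \<in> {G\<in>\<B>. G \<subseteq> W}"
          then have G: "openin Z G" using B1 by blast
          have "vaught Z X f G S \<in> borel_sigma X r s"
          proof (cases "underS r s = {}")
            case True
            \<comment> \<open>The induction hypothesis says nothing at level 0, where the only set
              is empty.\<close>
            then have "S = {}" using S(3) by (simp add: borel_sigma_0 [OF r])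
            then show ?thesis using True by (simp add: borel_sigma_0 [OF r] vaught_empty)
          next
            case False
            then show ?thesis using IH G by blast
          qed
          then show "f ` G - vaught Z X f G S \<in> borel_sigma X r t"
            using open_diff_borel_sigma [OF r high(2) S(2)] img [OF G] by blast
        qed
        finally show "vaught Z X f W C \<in> borel_sigma X r t" .
      qed
    qed
  qed
  then show ?thesis using assms by blast
qed

end

section \<open>A representation with Polish fibers\<close>

lemma topspace_baire [simp]: "topspace baire = UNIV"
  unfolding baire_def by simp

lemma openin_baire_coordinate: "openin baire {g. g m \<in> S}"
proof -
  have "continuous_map baire (discrete_topology UNIV) (\<lambda>g. g m)"
    unfolding baire_def by (rule continuous_map_product_projection) simp
  then have "openin baire {g \<in> topspace baire. g m \<in> S}"
    by (rule openin_continuous_map_preimage) simp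
  then show ?thesis by simp
qed

lemma openin_baire_cylinder: "openin baire {g. \<forall>i<n. g i = s i}"
proof -
  have "openin baire ((\<Inter>i\<in>{..<n}. {g. g i \<in> {s i}}) \<inter> topspace baire)"
    by (intro openin_INT openin_baire_coordinate) simp
  moreover have "(\<Inter>i\<in>{..<n}. {g. g i \<in> {s i}}) \<inter> topspace baire = {g. \<forall>i<n. g i = s i}"
    by auto
  ultimately show ?thesis by simp
qed

lemma openin_baire_contains_cylinder:
  assumes "openin baire W" "h \<in> W"
  obtains n where "{g. \<forall>i<n. g i = h i} \<subseteq> W"
proof -
  obtain U where U: "finite {i. U i \<noteq> (UNIV :: nat set)}" "h \<in> Pi\<^sub>E UNIV U" "Pi\<^sub>E UNIV U \<subseteq> W"
    using assms unfolding baire_def openin_product_topology_alt by auto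
  then obtain n where n: "\<And>i. U i \<noteq> UNIV \<Longrightarrow> i < n"
    using finite_nat_set_iff_bounded [of "{i. U i \<noteq> UNIV}"] by auto
  have "g \<in> Pi\<^sub>E UNIV U" if g: "\<forall>i<n. g i = h i" for g
  proof -
    have "g i \<in> U i" for i
      using g n [of i] U(2) by (cases "U i = UNIV") auto
    then show ?thesis by auto
  qed
  then show thesis
    using that [of n] U(3) by blast
qed

lemma second_countable_baire: "second_countable baire"
  unfolding second_countable_def
proof (intro exI conjI allI impI ballI)
  \<comment> \<open>Finite lists index the cylinders, which makes the base countable.\<close>
  let ?C = "\<lambda>s. {g :: nat \<Rightarrow> nat. \<forall>i<length s. g i = s ! i}"
  show "countable (range ?C)"
    by simp
  show "openin baire V" if "V \<in> range ?C" for V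
    using that openin_baire_cylinder by auto
  fix W h assume W: "openin baire W \<and> h \<in> W"
  then obtain n where n: "{g. \<forall>i<n. g i = h i} \<subseteq> W"
    using openin_baire_contains_cylinder by blast
  have "?C (map h [0..<n]) = {g. \<forall>i<n. g i = h i}"
    by auto
  then have "h \<in> ?C (map h [0..<n])" "?C (map h [0..<n]) \<subseteq> W"
    using n by simp_all
  then show "\<exists>V\<in>range ?C. h \<in> V \<and> V \<subseteq> W"
    by blast
qed

lemma completely_metrizable_space_baire: "completely_metrizable_space baire"
  unfolding baire_def completely_metrizable_space_product_topology
  by (simp add: completely_metrizable_space_discrete_topology)

text \<open>A point is represented by the enumerations of its set of basic neighbourhoods.\<close>
lemma exists_polish_fibers:
  fixes X :: "'a topology"
  assumes "second_countable X" "t0_space X"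
  obtains E \<rho> where "polish_fibers (subtopology baire E) X \<rho>"
    "continuous_map (subtopology baire E) X \<rho>" "\<rho> ` E = topspace X"
proof -
  obtain \<B> where cB: "countable \<B>" and B1: "\<And>V. V \<in> \<B> \<Longrightarrow> openin X V"
    and B2: "\<And>V x. openin X V \<Longrightarrow> x \<in> V \<Longrightarrow> \<exists>b\<in>\<B>. x \<in> b \<and> b \<subseteq> V"
    using assms(1) unfolding second_countable_def by metis
  \<comment> \<open>Adding the whole space makes the family nonempty, so that it is exactly the
    range of its enumeration even if the base is empty.\<close>
  define U where "U = from_nat_into (insert (topspace X) \<B>)"
  have rangeU: "range U = insert (topspace X) \<B>"
    unfolding U_def using cB by (intro range_from_nat_into) auto
  have openU: "openin X (U n)" for n
  proof -
    have "U n \<in> insert (topspace X) \<B>" using rangeU by blast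
    then show ?thesis using B1 by auto
  qed
  have baseU: "\<exists>n. x \<in> U n \<and> U n \<subseteq> V" if V: "openin X V" "x \<in> V" for V x
  proof -
    obtain b where b: "b \<in> \<B>" "x \<in> b" "b \<subseteq> V" using B2 [OF V] by blast
    then have "b \<in> range U" using rangeU by blast
    then show ?thesis using b by blast
  qed
  define N where "N x = {n. x \<in> U n}" for x
  have N_nonempty: "N x \<noteq> {}" if "x \<in> topspace X" for x
    using baseU [OF openin_topspace that] unfolding N_def by blast
  have N_inj: "x = y" if x: "x \<in> topspace X" and y: "y \<in> topspace X" and eq: "N x = N y" for x y
  proof (rule ccontr)
    assume "x \<noteq> y"
    then obtain V where V: "openin X V" "x \<notin> V \<longleftrightarrow> y \<in> V"
      using assms(2) x y unfolding t0_space_def by metis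
    have "x \<in> V \<longleftrightarrow> y \<in> V"
      using baseU [OF V(1), of x] baseU [OF V(1), of y] eq unfolding N_def by blast
    then show False using V(2) by blast
  qed
  \<comment> \<open>A code of \<open>x\<close> lists exactly the indices in \<open>N x\<close>. By
    \<open>N_inj\<close>, which rests on the T0 axiom, no sequence codes two points, so the
    description in \<rho> is unique on \<open>E\<close>.\<close>
  define E :: "(nat \<Rightarrow> nat) set" where "E = {h. \<exists>x\<in>topspace X. range h = N x}"
  define \<rho> :: "(nat \<Rightarrow> nat) \<Rightarrow> 'a" where "\<rho> h = (THE x. x \<in> topspace X \<and> range h = N x)" for h
  have \<rho>_eq: "\<rho> h = x" if "x \<in> topspace X" "range h = N x" for h x
    unfolding \<rho>_def using that N_inj by (intro the_equality) auto
  have \<rho>_in: "\<rho> h \<in> topspace X" "range h = N (\<rho> h)" if h: "h \<in> E" for h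
  proof -
    obtain x where x: "x \<in> topspace X" "range h = N x"
      using h unfolding E_def by blast
    then have "\<rho> h = x" by (rule \<rho>_eq)
    then show "\<rho> h \<in> topspace X" "range h = N (\<rho> h)"
      using x by simp_all
  qed
  \<comment> \<open>Any finite list of indices from \<open>N x\<close> begins some code of
    \<open>x\<close>: it is followed by an enumeration of all of \<open>N x\<close>. Both
    surjectivity and openness of \<rho> come from this.\<close>
  have extend: "\<exists>g\<in>E. (\<forall>i<n. g i = s i) \<and> \<rho> g = x"
    if x: "x \<in> topspace X" and s: "\<forall>i<n. s i \<in> N x" for x n and s :: "nat \<Rightarrow> nat"
  proof -
    define g where "g i = (if i < n then s i else from_nat_into (N x) (i - n))" for i
    have "range g = N x"
    proof (intro equalityI subsetI)
      fix m assume "m \<in> range g"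
      then show "m \<in> N x"
        using s from_nat_into [OF N_nonempty [OF x]] unfolding g_def by auto
    next
      fix m assume "m \<in> N x"
      then obtain j where "from_nat_into (N x) j = m"
        using from_nat_into_surj [of "N x" m] by auto
      then have "g (n + j) = m" unfolding g_def by simp
      then show "m \<in> range g" by blast
    qed
    then have "g \<in> E" "\<rho> g = x"
      using x \<rho>_eq unfolding E_def by blast+
    moreover have "\<forall>i<n. g i = s i" unfolding g_def by simp
    ultimately show ?thesis by blast
  qed
  have surj: "\<rho> ` E = topspace X"
    using \<rho>_in(1) extend [where n = 0] by (auto simp: image_iff)
  have cont: "continuous_map (subtopology baire E) X \<rho>"
    unfolding continuous_map_def
  proof (intro conjI allI impI)
    show "\<rho> \<in> topspace (subtopology baire E) \<rightarrow> topspace X"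
      using \<rho>_in(1) by auto
    fix V assume V: "openin X V"
    \<comment> \<open>A single entry of \<open>h\<close> witnesses membership, so the preimage is a
      union of conditions on one coordinate.\<close>
    have "\<rho> h \<in> V \<longleftrightarrow> (\<exists>m. U (h m) \<subseteq> V)" if h: "h \<in> E" for h
    proof
      assume "\<rho> h \<in> V"
      then obtain n where "\<rho> h \<in> U n" "U n \<subseteq> V"
        using baseU [OF V] by blast
      moreover from this have "n \<in> range h"
        using \<rho>_in(2) [OF h] unfolding N_def by blast
      ultimately show "\<exists>m. U (h m) \<subseteq> V" by blast
    next
      assume "\<exists>m. U (h m) \<subseteq> V"
      then show "\<rho> h \<in> V"
        using \<rho>_in(2) [OF h] unfolding N_def by blast
    qed
    then have "{h \<in> topspace (subtopology baire E). \<rho> h \<in> V} = E \<inter> (\<Union>m. {h. h m \<in> {n. U n \<subseteq> V}})"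
      by auto
    moreover have "openin baire (\<Union>m. {h. h m \<in> {n. U n \<subseteq> V}})"
      using openin_baire_coordinate by (intro openin_Union) blast
    ultimately show "openin (subtopology baire E) {h \<in> topspace (subtopology baire E). \<rho> h \<in> V}"
      by (simp only: openin_subtopology_Int2)
  qed
  have open_map: "open_map (subtopology baire E) X \<rho>"
    unfolding open_map_def
  proof (intro allI impI)
    fix W assume "openin (subtopology baire E) W"
    then obtain W' where W': "openin baire W'" "W = W' \<inter> E"
      unfolding openin_subtopology by blast
    show "openin X (\<rho> ` W)"
    proof (subst openin_subopen, intro ballI)
      fix x assume "x \<in> \<rho> ` W"
      then obtain h where h: "h \<in> W'" "h \<in> E" "x = \<rho> h"
        using W'(2) by blast
      obtain n where n: "{g. \<forall>i<n. g i = h i} \<subseteq> W'"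
        using openin_baire_contains_cylinder [OF W'(1) h(1)] by blast
      \<comment> \<open>By \<open>extend\<close>, every point of this finite intersection has a code
        with the same first \<open>n\<close> entries as \<open>h\<close>. The factor
        \<open>topspace X\<close> matters for \<open>n = 0\<close>.\<close>
      let ?O = "(\<Inter>i\<in>{..<n}. U (h i)) \<inter> topspace X"
      have "openin X ?O"
        by (intro openin_INT openU) auto
      moreover have "x \<in> ?O"
        using \<rho>_in [OF h(2)] h(3) unfolding N_def by blast
      moreover have "?O \<subseteq> \<rho> ` W"
      proof
        fix y assume y: "y \<in> ?O"
        then have "\<forall>i<n. h i \<in> N y" unfolding N_def by auto
        then obtain g where "g \<in> E" "\<forall>i<n. g i = h i" "\<rho> g = y"
          using extend y by blast
        then show "y \<in> \<rho> ` W"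
          using n W'(2) by blast
      qed
      ultimately show "\<exists>T. openin X T \<and> x \<in> T \<and> T \<subseteq> \<rho> ` W"
        by blast
    qed
  qed
  have fiber: "completely_metrizable_space (subtopology (subtopology baire E) {h. \<rho> h = x})"
    if x: "x \<in> topspace X" for x
  proof -
    \<comment> \<open>Being a code of \<open>x\<close> means that every entry lies in
      \<open>N x\<close> and that every element of \<open>N x\<close> occurs. These are countably
      many open conditions, so the fiber is a G-delta set of the whole Baire space, whatever
      \<open>E\<close> is.\<close>
    have "gdelta_in baire (\<Inter>(range (\<lambda>m. {h. h m \<in> N x}) \<union> (\<lambda>n. {h. n \<in> range h}) ` N x))"
    proof (rule gdelta_in_Inter)
      fix S :: "(nat \<Rightarrow> nat) set"
      assume "S \<in> range (\<lambda>m. {h. h m \<in> N x}) \<union> (\<lambda>n. {h. n \<in> range h}) ` N x"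
      then consider m where "S = {h. h m \<in> N x}" | n where "S = {h. n \<in> range h}"
        by blast
      then show "gdelta_in baire S"
      proof cases
        case 1
        then show ?thesis by (simp add: open_imp_gdelta_in openin_baire_coordinate)
      next
        case 2
        then have "S = (\<Union>m. {h. h m \<in> {n}})" by auto
        moreover have "openin baire (\<Union>m. {h. h m \<in> {n}})"
          using openin_baire_coordinate by (intro openin_Union) blast
        ultimately show ?thesis
          by (simp only: open_imp_gdelta_in)
      qed
    qed auto
    moreover have "(\<Inter>(range (\<lambda>m. {h. h m \<in> N x}) \<union> (\<lambda>n. {h. n \<in> range h}) ` N x)) = E \<inter> {h. \<rho> h = x}"
      (is "?L = ?R")
    proof (intro equalityI subsetI)
      fix h assume "h \<in> ?L"
      then have "range h = N x" by auto
      then show "h \<in> ?R" using x \<rho>_eq unfolding E_def by blast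
    next
      fix h assume "h \<in> ?R"
      then have "range h = N x" using \<rho>_in(2) by blast
      then show "h \<in> ?L" by auto
    qed
    ultimately show ?thesis
      unfolding subtopology_subtopology
      using completely_metrizable_space_gdelta_in [OF completely_metrizable_space_baire] by simp
  qed
  have "polish_fibers (subtopology baire E) X \<rho>"
    using surj open_map fiber second_countable_subtopology [OF second_countable_baire]
    by unfold_locales auto
  then show thesis using that cont surj by blast
qed

section \<open>Partitions defined by forests\<close>

text \<open>Preimages respect both the Borel level and the set operations in the definition. This
  gives the easy direction along \<delta>, and later the passage from \<open>D\<close> to
  \<open>E\<close>.\<close>

lemma sigma_forest_vimage:
  assumes f: "continuous_map Y Z f" and "Well_order r" "t \<in> Field r"
    and "sigma_forest Z r t k P le c A"
  shows "sigma_forest Y r t k P le c (A \<circ> f)"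
proof -
  obtain B where B: "\<forall>p\<in>P. B p \<in> borel_sigma Z r t" "(\<Union>p\<in>P. B p) = topspace Z"
    and A: "\<And>i. i < k \<Longrightarrow> {y \<in> topspace Z. A y = i} =
           (\<Union>p\<in>{p\<in>P. c p = i}. B p - (\<Union>q\<in>{q\<in>P. le q p \<and> q \<noteq> p}. B q))"
    using assms(4) unfolding sigma_forest_def by blast
  have fY: "f y \<in> topspace Z" if "y \<in> topspace Y" for y
    using f that by (auto simp: continuous_map_def)
  define C where "C p = {y \<in> topspace Y. f y \<in> B p}" for p
  have "C p \<in> borel_sigma Y r t" if "p \<in> P" for p
    unfolding C_def using borel_sigma_vimage [OF f assms(2,3)] B(1) that by blast
  moreover have "(\<Union>p\<in>P. C p) = topspace Y"
    using fY B(2) unfolding C_def by blast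
  moreover have "{y \<in> topspace Y. (A \<circ> f) y = i} =
      (\<Union>p\<in>{p\<in>P. c p = i}. C p - (\<Union>q\<in>{q\<in>P. le q p \<and> q \<noteq> p}. C q))" (is "?L = ?R")
    if "i < k" for i
  proof -
    have "?L = {y \<in> topspace Y. f y \<in> {z \<in> topspace Z. A z = i}}"
      using fY by auto
    also have "\<dots> = ?R"
      unfolding A [OF that] C_def by auto
    finally show ?thesis .
  qed
  ultimately show ?thesis
    unfolding sigma_forest_def by (intro exI [of _ C]) simp
qed

text \<open>A strictly descending sequence would be injective with a chain as its range, whereas
  chains in \<open>P\<close> are finite.\<close>

lemma k_forest_minimal:
  assumes "k_forest k P le c" and "S \<subseteq> P" "S \<noteq> {}"
  obtains p where "p \<in> S" "\<And>q. q \<in> S \<Longrightarrow> le q p \<Longrightarrow> q = p"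
proof -
  define R where "R = {(q, p). q \<in> P \<and> p \<in> P \<and> le q p \<and> q \<noteq> p}"
  have refl: "\<forall>x\<in>P. le x x"
    using assms(1) unfolding k_forest_def by (elim conjE)
  have anti: "\<forall>x\<in>P. \<forall>y\<in>P. le x y \<and> le y x \<longrightarrow> x = y"
    using assms(1) unfolding k_forest_def by (elim conjE)
  have trn: "\<forall>x\<in>P. \<forall>y\<in>P. \<forall>z\<in>P. le x y \<and> le y z \<longrightarrow> le x z"
    using assms(1) unfolding k_forest_def by (elim conjE)
  have fin: "\<forall>C. C \<subseteq> P \<and> (\<forall>x\<in>C. \<forall>y\<in>C. le x y \<or> le y x) \<longrightarrow> finite C"
    using assms(1) unfolding k_forest_def by (elim conjE)
  have "trans R"
  proof (rule transI)
    fix x y z assume "(x, y) \<in> R" "(y, z) \<in> R"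
    then have xyz: "x \<in> P" "y \<in> P" "z \<in> P" "le x y" "le y z" "x \<noteq> y"
      unfolding R_def by auto
    then have "le x z" using trn by blast
    moreover have "x \<noteq> z" using xyz anti by blast
    ultimately show "(x, z) \<in> R" using xyz unfolding R_def by blast
  qed
  have "wf R"
    unfolding wf_iff_no_infinite_down_chain
  proof
    assume "\<exists>f. \<forall>i. (f (Suc i), f i) \<in> R"
    then obtain f where f: "\<And>i. (f (Suc i), f i) \<in> R" by blast
    have desc: "(f j, f i) \<in> R" if "i < j" for i j
      using that
    proof (induction j)
      case (Suc j)
      then show ?case
        using f [of j] \<open>trans R\<close> by (metis less_Suc_eq transD)
    qed simp
    have "inj f"
      by (rule linorder_injI) (use desc in \<open>force simp: R_def\<close>)
    moreover have "finite (range f)"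
    proof (rule fin [rule_format], intro conjI)
      show "range f \<subseteq> P"
        using f unfolding R_def by blast
      have "le (f i) (f j) \<or> le (f j) (f i)" for i j
        using desc [of i j] desc [of j i] f [of i] refl unfolding R_def
        by (cases i j rule: linorder_cases) auto
      then show "\<forall>x\<in>range f. \<forall>y\<in>range f. le x y \<or> le y x"
        by blast
    qed
    ultimately show False
      using finite_imageD by blast
  qed
  then obtain p where "p \<in> S" "\<And>q. (q, p) \<in> R \<Longrightarrow> q \<notin> S"
    using wfE_min' [OF _ assms(3)] by blast
  then show thesis
    using that assms(2) unfolding R_def by blast
qed

lemma (in polish_fibers) sigma_forest_descends:
  assumes surj: "f ` topspace Z = topspace X"
    and r: "Well_order r" and t: "t \<in> Field r" "underS r t \<noteq> {}"
    and P: "k_forest k P le c"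
    and sf: "sigma_forest Z r t k P le c (A \<circ> f)"
  shows "sigma_forest X r t k P le c A"
proof -
  obtain B where B1: "\<forall>p\<in>P. B p \<in> borel_sigma Z r t" and B2: "(\<Union>p\<in>P. B p) = topspace Z"
    and AB: "\<forall>i<k. {z \<in> topspace Z. (A \<circ> f) z = i} =
           (\<Union>p\<in>{p\<in>P. c p = i}. B p - (\<Union>q\<in>{q\<in>P. le q p \<and> q \<noteq> p}. B q))"
    using sf unfolding sigma_forest_def by (elim exE conjE)
  have cP: "countable P" and ck: "\<And>p. p \<in> P \<Longrightarrow> c p < k"
    using P unfolding k_forest_def by simp_all
  define C where "C p = vaught Z X f (topspace Z) (B p)" for p
  have Cx: "p \<in> P \<Longrightarrow> x \<in> C p \<longleftrightarrow> x \<in> topspace X \<and>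
      \<not> meager_in (subtopology Z {z. f z = x}) ({z. f z = x} \<inter> B p)" for p x
  proof -
    assume "p \<in> P"
    then have "topspace Z \<inter> B p = B p"
      using B2 by blast
    then show ?thesis unfolding C_def vaught_def by simp
  qed
  have CB: "C p \<in> borel_sigma X r t" if "p \<in> P" for p
    unfolding C_def using vaught_borel_sigma [OF r t(1) B1 [rule_format, OF that] t(2)] by simp
  have cover: "\<exists>p\<in>P. x \<in> C p" if x: "x \<in> topspace X" for x
  proof (rule ccontr)
    let ?T = "subtopology Z {z. f z = x}"
    assume "\<not> (\<exists>p\<in>P. x \<in> C p)"
    then have "meager_in ?T (\<Union>p\<in>P. {z. f z = x} \<inter> B p)"
      using Cx x by (intro meager_in_UN [OF cP]) blast
    moreover have "(\<Union>p\<in>P. {z. f z = x} \<inter> B p) = topspace ?T"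
      using B2 by auto
    moreover have "topspace ?T \<noteq> {}"
      using x unfolding surj [symmetric] by auto
    ultimately show False
      using openin_not_meager [OF fiber [OF x] openin_topspace] by simp
  qed
  have label: "A x = c p"
    if p: "p \<in> P" and x: "x \<in> C p" and min: "\<And>q. q \<in> P \<Longrightarrow> le q p \<Longrightarrow> q \<noteq> p \<Longrightarrow> x \<notin> C q" for x p
  proof -
    let ?T = "subtopology Z {z. f z = x}"
    let ?Q = "{q\<in>P. le q p \<and> q \<noteq> p}"
    have xX: "x \<in> topspace X" and nonm: "\<not> meager_in ?T ({z. f z = x} \<inter> B p)"
      using x Cx [OF p] by blast+
    \<comment> \<open>Each \<open>B q\<close> below is meager on the fiber and there are countably
      many, so they cannot cover the nonmeager trace of \<open>B p\<close>. A point left over lies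
      above \<open>x\<close> and has label \<open>c p\<close>.\<close>
    have "meager_in ?T (\<Union>q\<in>?Q. {z. f z = x} \<inter> B q)"
    proof (rule meager_in_UN)
      show "countable ?Q" using cP by simp
      show "meager_in ?T ({z. f z = x} \<inter> B q)" if "q \<in> ?Q" for q
        using that min [of q] Cx [of q x] xX by blast
    qed
    then have "\<not> {z. f z = x} \<inter> B p \<subseteq> (\<Union>q\<in>?Q. {z. f z = x} \<inter> B q)"
      using nonm meager_in_mono by blast
    then obtain z where z: "f z = x" "z \<in> B p" "z \<notin> (\<Union>q\<in>?Q. B q)"
      by blast
    then have "z \<in> {z \<in> topspace Z. (A \<circ> f) z = c p}"
      unfolding AB [rule_format, OF ck [OF p]] using p by blast
    then show "A x = c p"
      using z(1) by simp
  qed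
  have "{x \<in> topspace X. A x = i} =
      (\<Union>p\<in>{p\<in>P. c p = i}. C p - (\<Union>q\<in>{q\<in>P. le q p \<and> q \<noteq> p}. C q))" (is "?L = ?R") for i
  proof (intro equalityI subsetI)
    fix x assume x: "x \<in> ?L"
    \<comment> \<open>\<open>label\<close> asks for a node none of whose strict predecessors has
      \<open>x\<close> in its set; a minimal node of this set is one.\<close>
    then have "{p\<in>P. x \<in> C p} \<noteq> {}"
      using cover by blast
    from k_forest_minimal [OF P _ this]
    obtain p where "p \<in> {p\<in>P. x \<in> C p}" "\<And>q. q \<in> {p\<in>P. x \<in> C p} \<Longrightarrow> le q p \<Longrightarrow> q = p"
      by auto
    then have p: "p \<in> P" "x \<in> C p" and min: "\<And>q. q \<in> P \<Longrightarrow> le q p \<Longrightarrow> q \<noteq> p \<Longrightarrow> x \<notin> C q"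
      by auto
    have "A x = c p"
      using label [OF p min] .
    then show "x \<in> ?R"
      using x p min by auto
  next
    fix x assume "x \<in> ?R"
    then obtain p where p: "p \<in> P" "c p = i" "x \<in> C p"
      and min: "\<And>q. q \<in> P \<Longrightarrow> le q p \<Longrightarrow> q \<noteq> p \<Longrightarrow> x \<notin> C q"
      by blast
    have "A x = i" using label [OF p(1,3) min] p(2) by simp
    then show "x \<in> ?L" using p(3) Cx [OF p(1)] by blast
  qed
  moreover have "(\<Union>p\<in>P. C p) = topspace X"
    using cover vaught_subset_topspace unfolding C_def by blast
  ultimately show ?thesis
    unfolding sigma_forest_def using CB by (intro exI [of _ C]) simp
qed

theorem theorem4p14:
  fixes k :: nat and X :: "'a topology" and D :: "(nat \<Rightarrow> nat) set"
    and \<delta> :: "(nat \<Rightarrow> nat) \<Rightarrow> 'a" and A :: "'a \<Rightarrow> nat"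
    and r :: "'i rel" and \<theta> :: 'i
    and P :: "'p set" and le :: "'p \<Rightarrow> 'p \<Rightarrow> bool" and c :: "'p \<Rightarrow> nat"
  assumes "k \<ge> 2"
    and "second_countable X" and "t0_space X"
    and "admissible_rep X D \<delta>"
    and "\<forall>x\<in>topspace X. A x < k"
    and "Well_order r" and "countable (Field r)" and "\<theta> \<in> Field r" and "underS r \<theta> \<noteq> {}"
    and "k_forest k P le c"
  shows "sigma_forest X r \<theta> k P le c A \<longleftrightarrow>
         sigma_forest (subtopology baire D) r \<theta> k P le c (A \<circ> \<delta>)"
proof
  assume "sigma_forest X r \<theta> k P le c A"
  moreover have "continuous_map (subtopology baire D) X \<delta>"
    using assms(4) unfolding admissible_rep_def by simp
  ultimately show "sigma_forest (subtopology baire D) r \<theta> k P le c (A \<circ> \<delta>)"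
    using assms(6,8) by (intro sigma_forest_vimage)
next
  assume D: "sigma_forest (subtopology baire D) r \<theta> k P le c (A \<circ> \<delta>)"
  obtain E \<rho> where E: "polish_fibers (subtopology baire E) X \<rho>"
    "continuous_map (subtopology baire E) X \<rho>" "\<rho> ` E = topspace X"
    using exists_polish_fibers [OF assms(2,3)] by blast
  have "\<forall>Z \<nu>. continuous_map (subtopology baire Z) X \<nu> \<longrightarrow>
      (\<exists>g. continuous_map (subtopology baire Z) (subtopology baire D) g \<and> (\<forall>z\<in>Z. \<nu> z = \<delta> (g z)))"
    using assms(4) unfolding admissible_rep_def by (elim conjE)
  then obtain g where g: "continuous_map (subtopology baire E) (subtopology baire D) g"
    "\<forall>z\<in>E. \<rho> z = \<delta> (g z)"
    using E(2) by blast
  have "sigma_forest (subtopology baire E) r \<theta> k P le c (A \<circ> \<delta> \<circ> g)"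
    using sigma_forest_vimage [OF g(1) assms(6,8) D] .
  \<comment> \<open>\<open>A \<circ> \<delta> \<circ> g\<close> and \<open>A \<circ> \<rho>\<close>
    are known to agree only on \<open>E\<close>, and \<open>sigma_forest\<close> looks at values
    only there.\<close>
  moreover have "{z \<in> topspace (subtopology baire E). (A \<circ> \<delta> \<circ> g) z = i} =
      {z \<in> topspace (subtopology baire E). (A \<circ> \<rho>) z = i}" for i
    using g(2) by auto
  ultimately have "sigma_forest (subtopology baire E) r \<theta> k P le c (A \<circ> \<rho>)"
    unfolding sigma_forest_def by simp
  then show "sigma_forest X r \<theta> k P le c A"
    using polish_fibers.sigma_forest_descends [OF E(1)] E(3) assms(6,8-10) by simp
qed

end
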